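(* Let $f(z)=z+\sum_{n=2}^{\infty}a_nz^n$ belong to the class $\mathcal{SL}^*$. Then $$|a_3^2-a_5|\le\frac18.$$ The estimate is sharp, i.e. there exists a function $f\in\mathcal{SL}^*$ for which $|a_3^2-a_5|=\frac18$.
   Context: $\Delta=\{z\in\mathbb{C}:|z|<1\}$ is the open unit disk. $\mathcal{A}$ is the class of analytic functions on $\Delta$ of the form $f(z)=z+\sum_{n=2}^{\infty}a_nz^n$. For analytic functions $F,G$ on $\Delta$, $F$ is subordinate to $G$, written $F\prec G$, if there is an analytic function $\omega:\Delta\to\mathbb{C}$ with $\omega(0)=0$ and $|\omega(z)|<1$ for $z\in\Delta$ such that $F(z)=G(\omega(z))$ for all $z\in\Delta$. The class $\mathcal{SL}^*$ is $$\mathcal{SL}^*=\left\{f\in\mathcal{A}:\ \frac{zf'(z)}{f(z)}\prec\sqrt{1+z},\ z\in\Delta\right\},$$ where $\sqrt{\cdot}$ is the principal branch (value $1$ at $z=0$), and $zf'(z)/f(z)$ is understood to take the value $1$ at $z=0$. *)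

theory Defs
  imports "HOL-Complex_Analysis.Complex_Analysis"
begin

abbreviation unit_disk :: "complex set" where
  "unit_disk \<equiv> ball 0 1"

(* f(z) = z + sum_{n>=2} a_n z^n on the disk; the values a 0 and a 1 play no role *)
definition normalized_expansion :: "(complex \<Rightarrow> complex) \<Rightarrow> (nat \<Rightarrow> complex) \<Rightarrow> bool" where
  "normalized_expansion f a \<longleftrightarrow>
     (\<forall>z\<in>unit_disk. (\<lambda>n. a (n + 2) * z ^ (n + 2)) sums (f z - z))"

definition class_A :: "(complex \<Rightarrow> complex) set" where
  "class_A = {f. f holomorphic_on unit_disk \<and> (\<exists>a. normalized_expansion f a)}"

definition subordinate :: "(complex \<Rightarrow> complex) \<Rightarrow> (complex \<Rightarrow> complex) \<Rightarrow> bool" where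
  "subordinate F G \<longleftrightarrow>
     F holomorphic_on unit_disk \<and> G holomorphic_on unit_disk \<and>
     (\<exists>\<omega>. \<omega> holomorphic_on unit_disk \<and> \<omega> 0 = 0 \<and>
          (\<forall>z\<in>unit_disk. cmod (\<omega> z) < 1) \<and>
          (\<forall>z\<in>unit_disk. F z = G (\<omega> z)))"

(* z f'(z) / f(z) with its limit value 1 at the origin *)
definition log_deriv_quotient :: "(complex \<Rightarrow> complex) \<Rightarrow> complex \<Rightarrow> complex" where
  "log_deriv_quotient f z = (if z = 0 then 1 else z * deriv f z / f z)"

(* A zero of f at some z \<noteq> 0 in the disk is excluded by the subordination: the quotient
   would be 0 there (division by zero), but csqrt (1 + w) is never 0 for |w| < 1. *)
definition SL_star :: "(complex \<Rightarrow> complex) set" where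
  "SL_star = {f \<in> class_A. subordinate (log_deriv_quotient f) (\<lambda>z. csqrt (1 + z))}"

end

theory Submission
  imports Defs
begin

text \<open>
  Write \<open>z f'(z) / f(z) = sqrt (1 + z \<phi>(z))\<close> with \<open>\<bar>\<phi>\<bar> \<le> 1\<close> (Schwarz) and let \<open>p\<^sub>k\<close> be the Taylor
  coefficients of \<open>\<phi>\<close>. Comparing coefficients gives
  \<open>8 (a\<^sub>5 - a\<^sub>3\<^sup>2) = p\<^sub>3 + p\<^sub>0 p\<^sub>2 / 6 - p\<^sub>1\<^sup>2 / 2 - p\<^sub>0\<^sup>2 p\<^sub>1 / 12 - 5 p\<^sub>0\<^sup>4 / 96\<close>.
  Three steps of the Schur algorithm express \<open>p\<^sub>0, \<dots>, p\<^sub>3\<close> through four parameters in the closed unit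
  disk; the triangle inequality then reduces the bound to a real inequality in the moduli of
  the first three parameters. Equality holds for \<open>\<phi>(z) = z\<^sup>3\<close>.
\<close>

section \<open>A real inequality for the moduli of the Schur parameters\<close>

text \<open>Here \<open>x\<close>, \<open>y\<close>, \<open>t\<close> stand for the moduli of the
  first three Schur parameters; the fourth has been estimated by 1. Equality holds at
  \<open>x = y = t = 0\<close>, so small \<open>y\<close> leaves no room for rounding. The parameter
  \<open>t\<close> is eliminated first, then the range of \<open>y\<close> is cut into pieces on
  which \<open>?B\<close> has a bound linear in \<open>u = x^2\<close> with constant
  coefficients.\<close>

lemma Schur_parameter_inequality:
  fixes x y t :: real
  assumes x: "0 \<le> x" "x \<le> 1" and y: "0 \<le> y" "y \<le> 1" and t: "0 \<le> t" "t \<le> 1"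
  shows "(1 - x\<^sup>2) * ((1 - y\<^sup>2) * (1 - (1 - y) * t\<^sup>2 + (2 * y + 1 / 6) * x * t) + x\<^sup>2 * y ^ 3
           + x\<^sup>2 * y\<^sup>2 / 6 + (1 - x\<^sup>2) * y\<^sup>2 / 2 + x\<^sup>2 * y / 12) + 5 * x ^ 4 / 96 \<le> 1"
    (is "(1 - x\<^sup>2) * ?B + _ \<le> 1")
proof -
  define u where "u = x\<^sup>2"
  have u: "0 \<le> u" "u \<le> 1" using x by (auto simp: u_def power_le_one)
  have x4: "x ^ 4 = u\<^sup>2" by (simp add: u_def)
  have x_le: "x \<le> 1 / 4 + u"
    using zero_le_power2[of "x - 1 / 2"] by (simp add: u_def power2_diff) (simp add: power2_eq_square)
  have y2_le: "y\<^sup>2 \<le> 1" using y by (simp add: power_le_one)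
  \<comment> \<open>after the linear bound on \<open>?B\<close>, the claim is a quadratic inequality in \<open>u\<close> with nonpositive discriminant\<close>
  have quad: ?thesis
    if B: "?B \<le> M + N * u" and N: "N > 5 / 96" and disc: "(N - M)\<^sup>2 \<le> 4 * (N - 5 / 96) * (1 - M)" for M N
  proof -
    have bound: "(1 - u) * ?B \<le> (1 - u) * (M + N * u)"
      using B u by (intro mult_left_mono) auto
    have "0 \<le> (2 * (N - 5 / 96) * u - (N - M))\<^sup>2 + (4 * (N - 5 / 96) * (1 - M) - (N - M)\<^sup>2)"
      using disc by simp
    also have "\<dots> = (4 * (N - 5 / 96)) * (1 - (1 - u) * (M + N * u) - 5 * u\<^sup>2 / 96)"
      by (simp add: field_simps power2_eq_square)
    finally have "0 \<le> (4 * (N - 5 / 96)) * (1 - (1 - u) * (M + N * u) - 5 * u\<^sup>2 / 96)" .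
    then have "0 \<le> 1 - (1 - u) * (M + N * u) - 5 * u\<^sup>2 / 96"
      using N by (simp add: zero_le_mult_iff)
    with bound show ?thesis by (simp add: x4 u_def[symmetric])
  qed
  show ?thesis
  \<comment> \<open>Up to 17/20 the negative term in \<open>t^2\<close> absorbs the term linear in
    \<open>t\<close>. Its factor \<open>1 - y\<close> degenerates near \<open>y = 1\<close>, but
    there \<open>1 - y^2\<close> is at most 111/400 and crude estimates suffice.\<close>
  proof (cases "y \<le> 17 / 20")
    case True
    \<comment> \<open>The first summand is the cost of completing the square in \<open>t\<close>;
      the other three are the coefficients of \<open>u\<close> already visible in \<open>?B\<close>.
      The decreasing part \<open>- y^2 / 2\<close> is kept outside, so that \<open>K\<close> is
      monotone.\<close>
    define K where "K c = (1 + c) * (2 * c + 1 / 6)\<^sup>2 / 4 + c ^ 3 + c\<^sup>2 / 6 + c / 12" for c :: real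
    have K_mono: "K y \<le> K c" if "y \<le> c" for c
      unfolding K_def using y that
      by (intro add_mono divide_right_mono mult_mono power_mono) auto
    have "0 \<le> (1 + y) * ((1 - y) * t - (2 * y + 1 / 6) * x / 2)\<^sup>2"
      using y by simp
    then have B0: "?B \<le> 1 - y\<^sup>2 / 2 + (K y - y\<^sup>2 / 2) * u"
      unfolding K_def u_def by (simp add: field_simps power2_eq_square power3_eq_cube)
    \<comment> \<open>On an interval from \<open>d\<close> to \<open>c\<close>, the decreasing terms
      are estimated at the left endpoint and \<open>K\<close> at the right one. This yields the
      constants \<open>M\<close> and \<open>N\<close> required by \<open>quad\<close>.\<close>
    have B: "?B \<le> 1 - d\<^sup>2 / 2 + (k - d\<^sup>2 / 2) * u"
      if "0 \<le> d" "d \<le> y" "y \<le> c" "K c \<le> k" for c d k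
    proof -
      have "d\<^sup>2 \<le> y\<^sup>2" using that by (intro power_mono) auto
      moreover have "K y - y\<^sup>2 / 2 \<le> k - d\<^sup>2 / 2"
        using \<open>d\<^sup>2 \<le> y\<^sup>2\<close> K_mono[OF \<open>y \<le> c\<close>] that by linarith
      then have "(K y - y\<^sup>2 / 2) * u \<le> (k - d\<^sup>2 / 2) * u"
        using u by (intro mult_right_mono)
      ultimately show ?thesis using B0 by linarith
    qed
    consider "y \<le> 11/20" | "11/20 \<le> y" "y \<le> 3/4" | "3/4 \<le> y" using True by linarith
    then show ?thesis
    proof cases
      case 1
      \<comment> \<open>With \<open>d = 0\<close> one has \<open>M = 1\<close>, so the discriminant
        condition forces \<open>N = 1\<close>: \<open>K\<close> must stay below 1, which determines
        how far this interval may reach.\<close>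
      show ?thesis
        by (rule quad[OF B[of 0 "11/20" 1]]) (use 1 y in \<open>auto simp: K_def power2_eq_square power3_eq_cube\<close>)
    next
      case 2
      show ?thesis
        by (rule quad[OF B[of "11/20" "3/4" "9/5"]]) (use 2 in \<open>auto simp: K_def power2_eq_square power3_eq_cube\<close>)
    next
      case 3
      show ?thesis
        by (rule quad[OF B[of "3/4" "17/20" "49/20"]]) (use 3 True in \<open>auto simp: K_def power2_eq_square power3_eq_cube\<close>)
    qed
  next
    case False
    have "(17 / 20)\<^sup>2 \<le> y\<^sup>2" using False by (intro power_mono) auto
    then have Y: "0 \<le> 1 - y\<^sup>2" "1 - y\<^sup>2 \<le> 111 / 400"
      using y2_le by (auto simp: power2_eq_square)
    have "(2 * y + 1 / 6) * x * t \<le> (13 / 6) * (1 / 4 + u) * 1"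
      using x y t x_le u by (intro mult_mono) auto
    moreover have "0 \<le> (1 - y) * t\<^sup>2" using y by simp
    ultimately have "1 - (1 - y) * t\<^sup>2 + (2 * y + 1 / 6) * x * t \<le> 1 + (13 / 6) * (1 / 4 + u)"
      by simp
    then have "(1 - y\<^sup>2) * (1 - (1 - y) * t\<^sup>2 + (2 * y + 1 / 6) * x * t)
        \<le> (1 - y\<^sup>2) * (1 + (13 / 6) * (1 / 4 + u))"
      using Y by (intro mult_left_mono)
    also have "\<dots> \<le> 111 / 400 * (1 + (13 / 6) * (1 / 4 + u))"
      using Y u by (intro mult_right_mono) auto
    finally have "(1 - y\<^sup>2) * (1 - (1 - y) * t\<^sup>2 + (2 * y + 1 / 6) * x * t)
        \<le> 111 / 400 * (1 + (13 / 6) * (1 / 4 + u))" .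
    moreover have "u * y ^ 3 \<le> u" "u * y\<^sup>2 \<le> u" "(1 - u) * y\<^sup>2 \<le> 1 - u" "u * y \<le> u"
      using u y by (auto intro!: mult_left_le simp: power_le_one)
    \<comment> \<open>The two decimals round up \<open>111/400 * 37/24 + 1/2\<close> and
      \<open>111/400 * 13/6 + 3/4\<close>.\<close>
    moreover have "V + A + B / 6 + C / 2 + D / 12 \<le> 93 / 100 + 1352 / 1000 * u"
      if "V \<le> 111 / 400 * (1 + (13 / 6) * (1 / 4 + u))" "A \<le> u" "B \<le> u" "C \<le> 1 - u" "D \<le> u"
      for V A B C D
      using that u by (simp add: field_simps)
    ultimately have "?B \<le> 93 / 100 + 1352 / 1000 * u"
      unfolding u_def[symmetric] by blast
    then show ?thesis
      by (rule quad) (auto simp: power2_eq_square)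
  qed
qed

section \<open>The Schwarz lemma and the Schur algorithm\<close>

text \<open>At the origin the bound is the derivative part of the Schwarz lemma, elsewhere it is the
  growth part. It cannot be strict, since \<open>f\<close> may be a rotation.\<close>

lemma Schwarz_factor:
  assumes f: "f holomorphic_on ball 0 1" "f 0 = 0" and no: "\<And>z. norm z < 1 \<Longrightarrow> norm (f z) < 1"
  obtains h where "h holomorphic_on ball 0 1" "\<And>z. norm z < 1 \<Longrightarrow> f z = z * h z"
    "\<And>z. norm z < 1 \<Longrightarrow> norm (h z) \<le> 1"
proof -
  obtain h where h: "h holomorphic_on ball 0 1" "\<And>z. norm z < 1 \<Longrightarrow> f z = z * h z" "deriv f 0 = h 0"
    by (rule Schwarz3[OF f]) auto
  have "norm (h z) \<le> 1" if z: "norm z < 1" for z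
  proof (cases "z = 0")
    case True
    then show ?thesis using Schwarz_Lemma(2)[OF f no, of 0] h(3) by simp
  next
    case False
    then show ?thesis using Schwarz_Lemma(1)[OF f no z] h(2)[OF z] by (simp add: norm_mult)
  qed
  with h show ?thesis using that by blast
qed

text \<open>A nonconstant \<open>f\<close> has modulus below 1 by the maximum principle, so the disk
  automorphism sending \<open>f 0\<close> to 0 can be applied and the result divided by
  \<open>z\<close>. Clearing the denominator in the inverse transformation lets the same identity
  cover constant \<open>f\<close>, including unimodular ones, with \<open>g = 0\<close>.\<close>

lemma Schur_step:
  assumes f: "f holomorphic_on ball 0 1" and le: "\<And>z. norm z < 1 \<Longrightarrow> norm (f z) \<le> 1"
  obtains g where "g holomorphic_on ball 0 1" "\<And>z. norm z < 1 \<Longrightarrow> norm (g z) \<le> 1"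
    "\<And>z. norm z < 1 \<Longrightarrow> f z * (1 + cnj (f 0) * (z * g z)) = f 0 + z * g z"
proof (cases "f constant_on ball 0 1")
  case True
  then have const: "f z = f 0" if "norm z < 1" for z
    using that unfolding constant_on_def by (metis mem_ball_0 norm_zero zero_less_one)
  show ?thesis
  proof
    show "f z * (1 + cnj (f 0) * (z * 0)) = f 0 + z * 0" if "norm z < 1" for z
      using const[OF that] by simp
  qed auto
next
  case False
  have lt: "norm (f z) < 1" if z: "norm z < 1" for z
  proof (rule ccontr)
    assume "\<not> norm (f z) < 1"
    then have "norm (f w) \<le> norm (f z)" if "w \<in> ball 0 1" for w
      using le[of w] that by simp
    then have "f constant_on ball 0 1"
      using z by (intro maximum_modulus_principle[OF f, where U = "ball 0 1" and \<xi> = z]) auto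
    then show False using False by simp
  qed
  define m where "m = (\<lambda>z. Moebius_function 0 (f 0) (f z))"
  have "f ` ball 0 1 \<subseteq> ball 0 1"
    using lt by auto
  then have m_hol: "m holomorphic_on ball 0 1"
    using holomorphic_on_compose_gen[OF f Moebius_function_holomorphic[OF lt[of 0], of 0]]
    by (simp add: o_def m_def)
  have m0: "m 0 = 0" by (simp add: m_def Moebius_function_eq_zero)
  have m_lt: "norm (m z) < 1" if "norm z < 1" for z
    unfolding m_def using that lt by (intro Moebius_function_norm_lt_1) auto
  obtain g where g: "g holomorphic_on ball 0 1" "\<And>z. norm z < 1 \<Longrightarrow> m z = z * g z"
    "\<And>z. norm z < 1 \<Longrightarrow> norm (g z) \<le> 1"
    using Schwarz_factor[OF m_hol m0 m_lt] by blast
  have "f z * (1 + cnj (f 0) * (z * g z)) = f 0 + z * g z" if z: "norm z < 1" for z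
  proof -
    have "norm (cnj (f 0) * f z) < 1"
      using norm_mult_less[of "cnj (f 0)" 1 "f z" 1] lt[of 0] lt[OF z] by simp
    then have "1 - cnj (f 0) * f z \<noteq> 0" by auto
    moreover have "z * g z = (f z - f 0) / (1 - cnj (f 0) * f z)"
      using g(2)[OF z] by (simp add: m_def Moebius_function_simple)
    ultimately have "z * g z * (1 - cnj (f 0) * f z) = f z - f 0" by simp
    then show ?thesis by (simp add: algebra_simps)
  qed
  with g show ?thesis using that by blast
qed

section \<open>Passage to formal power series\<close>

lemma holomorphic_unit_disk_fps:
  "f holomorphic_on ball 0 1 \<Longrightarrow> f has_fps_expansion fps_expansion f 0" for f :: "complex \<Rightarrow> complex"
  by (rule has_fps_expansion_fps_expansion[of "ball 0 1"]) auto

lemma fps_eqI_unit_disk: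
  fixes f g :: "complex \<Rightarrow> complex"
  assumes "f has_fps_expansion F" "g has_fps_expansion G" "\<And>z. norm z < 1 \<Longrightarrow> f z = g z"
  shows "F = G"
proof -
  have "eventually (\<lambda>z. f z = g z) (nhds 0)"
    using assms(3) by (intro eventually_nhds_in_open[of "ball 0 1", THEN eventually_mono]) auto
  then have "g has_fps_expansion F"
    using assms(1) has_fps_expansion_cong by blast
  then show ?thesis using assms(2) fps_expansion_unique_complex by blast
qed

text \<open>As an identity of power series, the Schur step determines the coefficients of
  \<open>F\<close> recursively from \<open>fps_nth F 0\<close> and the coefficients of
  \<open>G\<close>.\<close>

lemma Schur_step_coeffs:
  assumes f: "f holomorphic_on ball 0 1" and le: "\<And>z. norm z < 1 \<Longrightarrow> norm (f z) \<le> 1"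
    and F: "f has_fps_expansion F"
  obtains g G where "g holomorphic_on ball 0 1" "\<And>z. norm z < 1 \<Longrightarrow> norm (g z) \<le> 1"
    "g has_fps_expansion G"
    "F * (1 + fps_const (cnj (fps_nth F 0)) * (fps_X * G)) = fps_const (fps_nth F 0) + fps_X * G"
proof -
  obtain g where g: "g holomorphic_on ball 0 1" "\<And>z. norm z < 1 \<Longrightarrow> norm (g z) \<le> 1"
    "\<And>z. norm z < 1 \<Longrightarrow> f z * (1 + cnj (f 0) * (z * g z)) = f 0 + z * g z"
    using Schur_step[OF f le] by blast
  have f0: "f 0 = fps_nth F 0"
    using has_fps_expansion_imp_0_eq_fps_nth_0[OF F] by simp
  define G where "G = fps_expansion g 0"
  have G: "g has_fps_expansion G"
    unfolding G_def by (rule holomorphic_unit_disk_fps[OF g(1)])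
  have "F * (1 + fps_const (cnj (fps_nth F 0)) * (fps_X * G)) = fps_const (fps_nth F 0) + fps_X * G"
    by (rule fps_eqI_unit_disk[where f = "\<lambda>z. f z * (1 + cnj (f 0) * (z * g z))" and g = "\<lambda>z. f 0 + z * g z"])
       (use g(3) in \<open>auto simp: f0 intro!: fps_expansion_intros F G\<close>)
  with g G show ?thesis using that by blast
qed

lemma norm_nth_0_le:
  assumes "\<And>z. norm z < 1 \<Longrightarrow> norm (f z) \<le> 1" "f has_fps_expansion (F :: complex fps)"
  shows "norm (fps_nth F 0) \<le> 1"
  using assms(1)[of 0] has_fps_expansion_imp_0_eq_fps_nth_0[OF assms(2)] by simp

section \<open>The coefficient functional and its bound\<close>

text \<open>Both sides are polynomials in the coefficients of \<open>H\<close>: \<open>FH\<close>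
  yields those of \<open>F\<close> recursively, \<open>HP\<close> yields those of \<open>P\<close>
  directly, and the polynomials agree.\<close>

lemma sqrt_log_deriv_coeffs:
  fixes F H P :: "complex fps"
  assumes F: "fps_nth F 0 = 0" "fps_nth F 1 = 1" and H: "fps_nth H 0 = 1"
    and FH: "fps_X * fps_deriv F = F * H" and HP: "H * H = 1 + fps_X * P"
  shows "8 * (fps_nth F 5 - (fps_nth F 3)\<^sup>2) = fps_nth P 3 + fps_nth P 0 * fps_nth P 2 / 6
     - (fps_nth P 1)\<^sup>2 / 2 - (fps_nth P 0)\<^sup>2 * fps_nth P 1 / 12 - 5 * fps_nth P 0 ^ 4 / 96"
proof -
  have 1: "fps_nth (fps_X * fps_deriv F) n = fps_nth (F * H) n" for n using FH by simp
  have 2: "fps_nth (H * H) n = fps_nth (1 + fps_X * P) n" for n using HP by simp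
  note E = fps_mult_nth numeral_eq_Suc F[simplified] H algebra_simps
  \<comment> \<open>Coefficient \<open>n\<close> of \<open>fps_X * fps_deriv F\<close> is
    \<open>n * fps_nth F n\<close>; cancelling the term with \<open>fps_nth H 0 = 1\<close> leaves
    the factor \<open>n - 1\<close>.\<close>
  have a: "fps_nth F 2 = fps_nth H 1" using 1[of 2] by (simp add: E)
  have b: "2 * fps_nth F 3 = fps_nth F 2 * fps_nth H 1 + fps_nth H 2" using 1[of 3] by (simp add: E)
  have c: "3 * fps_nth F 4 = fps_nth F 3 * fps_nth H 1 + fps_nth F 2 * fps_nth H 2 + fps_nth H 3"
    using 1[of 4] by (simp add: E)
  have d: "4 * fps_nth F 5 = fps_nth F 4 * fps_nth H 1 + fps_nth F 3 * fps_nth H 2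
      + fps_nth F 2 * fps_nth H 3 + fps_nth H 4"
    using 1[of 5] by (simp add: E)
  have p0: "fps_nth P 0 = 2 * fps_nth H 1" using 2[of 1] by (simp add: E)
  have p1: "fps_nth P 1 = 2 * fps_nth H 2 + (fps_nth H 1)\<^sup>2" using 2[of 2] by (simp add: E)
  have p2: "fps_nth P 2 = 2 * fps_nth H 3 + 2 * fps_nth H 1 * fps_nth H 2" using 2[of 3] by (simp add: E)
  have p3: "fps_nth P 3 = 2 * fps_nth H 4 + 2 * fps_nth H 1 * fps_nth H 3 + (fps_nth H 2)\<^sup>2"
    using 2[of 4] by (simp add: E)
  have b': "fps_nth F 3 = ((fps_nth H 1)\<^sup>2 + fps_nth H 2) / 2"
    using a b by (simp add: field_simps power2_eq_square)
  have c': "fps_nth F 4 = (fps_nth F 3 * fps_nth H 1 + fps_nth H 1 * fps_nth H 2 + fps_nth H 3) / 3"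
    using a c by (simp add: field_simps)
  have d': "fps_nth F 5 = (fps_nth F 4 * fps_nth H 1 + fps_nth F 3 * fps_nth H 2
      + fps_nth H 1 * fps_nth H 3 + fps_nth H 4) / 4"
    using a d by (simp add: field_simps)
  show ?thesis
    unfolding p0 p1 p2 p3 d' c' b'
    by (simp add: field_simps power2_eq_square power4_eq_xxxx)
qed

lemma bounded_coeff_functional_le_1:
  assumes f: "f holomorphic_on ball 0 1" and le: "\<And>z. norm z < 1 \<Longrightarrow> norm (f z) \<le> 1"
    and P: "f has_fps_expansion P"
  shows "norm (fps_nth P 3 + fps_nth P 0 * fps_nth P 2 / 6
     - (fps_nth P 1)\<^sup>2 / 2 - (fps_nth P 0)\<^sup>2 * fps_nth P 1 / 12 - 5 * fps_nth P 0 ^ 4 / 96) \<le> 1"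
    (is "norm ?L \<le> 1")
proof -
  obtain g Q where g: "g holomorphic_on ball 0 1" "\<And>z. norm z < 1 \<Longrightarrow> norm (g z) \<le> 1"
    "g has_fps_expansion Q"
    and PQ: "P * (1 + fps_const (cnj (fps_nth P 0)) * (fps_X * Q)) = fps_const (fps_nth P 0) + fps_X * Q"
    using Schur_step_coeffs[OF f le P] by blast
  obtain h R where h: "h holomorphic_on ball 0 1" "\<And>z. norm z < 1 \<Longrightarrow> norm (h z) \<le> 1"
    "h has_fps_expansion R"
    and QR: "Q * (1 + fps_const (cnj (fps_nth Q 0)) * (fps_X * R)) = fps_const (fps_nth Q 0) + fps_X * R"
    using Schur_step_coeffs[OF g] by blast
  obtain k S where k: "k holomorphic_on ball 0 1" "\<And>z. norm z < 1 \<Longrightarrow> norm (k z) \<le> 1"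
    "k has_fps_expansion S"
    and RS: "R * (1 + fps_const (cnj (fps_nth R 0)) * (fps_X * S)) = fps_const (fps_nth R 0) + fps_X * S"
    using Schur_step_coeffs[OF h] by blast
  define a b c d where "a = fps_nth P 0" "b = fps_nth Q 0" "c = fps_nth R 0" "d = fps_nth S 0"
  note abcd = this
  define x y t where "x = norm a" "y = norm b" "t = norm c"
  note xyt = this
  have le1: "x \<le> 1" "y \<le> 1" "t \<le> 1" "norm d \<le> 1"
    using norm_nth_0_le[OF le P] norm_nth_0_le[OF g(2,3)] norm_nth_0_le[OF h(2,3)] norm_nth_0_le[OF k(2,3)]
    by (auto simp: abcd xyt)
  have ge0: "x \<ge> 0" "y \<ge> 0" "t \<ge> 0" by (auto simp: xyt)
  have sq: "a * cnj a = of_real (x\<^sup>2)" "b * cnj b = of_real (y\<^sup>2)" "c * cnj c = of_real (t\<^sup>2)"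
    by (simp_all only: xyt complex_norm_square)
  define X Y T where "X = 1 - x\<^sup>2" "Y = 1 - y\<^sup>2" "T = 1 - t\<^sup>2"
  note XYT = this
  have XYT0: "X \<ge> 0" "Y \<ge> 0" "T \<ge> 0" using le1 ge0 by (auto simp: XYT power_le_one)
  \<comment> \<open>In terms of conjugates, the coefficient formulas below become polynomial
    identities.\<close>
  have XYTc: "of_real X = 1 - a * cnj a" "of_real Y = 1 - b * cnj b" "of_real T = 1 - c * cnj c"
    by (auto simp: XYT sq)
  note E = fps_mult_nth numeral_eq_Suc algebra_simps
  have 1: "fps_nth (P * (1 + fps_const (cnj a) * (fps_X * Q))) n = fps_nth (fps_const a + fps_X * Q) n" for n
    using PQ by (simp add: abcd)
  have 2: "fps_nth (Q * (1 + fps_const (cnj b) * (fps_X * R))) n = fps_nth (fps_const b + fps_X * R) n" for n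
    using QR by (simp add: abcd)
  have 3: "fps_nth (R * (1 + fps_const (cnj c) * (fps_X * S))) n = fps_nth (fps_const c + fps_X * S) n" for n
    using RS by (simp add: abcd)
  have r1: "fps_nth R 1 = T * d" using 3[of 1] by (simp add: E XYTc abcd)
  have q1: "fps_nth Q 1 = Y * c" using 2[of 1] by (simp add: E XYTc abcd)
  have q2: "fps_nth Q 2 = Y * (fps_nth R 1 - cnj b * c\<^sup>2)"
  proof -
    have "fps_nth Q 2 + cnj b * (b * fps_nth R 1 + fps_nth Q 1 * c) = fps_nth R 1"
      using 2[of 2] by (simp add: E abcd)
    then show ?thesis unfolding q1 by (simp add: XYTc algebra_simps power2_eq_square)
  qed
  have p1: "fps_nth P 1 = X * b" using 1[of 1] by (simp add: E XYTc abcd)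
  have p2: "fps_nth P 2 = X * (fps_nth Q 1 - cnj a * b\<^sup>2)"
  proof -
    have "fps_nth P 2 + cnj a * (a * fps_nth Q 1 + fps_nth P 1 * b) = fps_nth Q 1"
      using 1[of 2] by (simp add: E abcd)
    then show ?thesis unfolding p1 by (simp add: XYTc algebra_simps power2_eq_square)
  qed
  have p3: "fps_nth P 3 = X * (fps_nth Q 2 - 2 * cnj a * b * fps_nth Q 1 + (cnj a)\<^sup>2 * b ^ 3)"
  proof -
    have "fps_nth P 3 + cnj a * (a * fps_nth Q 2 + fps_nth P 1 * fps_nth Q 1 + fps_nth P 2 * b) = fps_nth Q 2"
      using 1[of 3] by (simp add: E abcd)
    then show ?thesis unfolding p1 p2 by (simp add: XYTc algebra_simps power2_eq_square power3_eq_cube)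
  qed
  \<comment> \<open>Coefficients 1 to 3 of \<open>P\<close> all contain the factor \<open>X\<close>,
    so only the pure power of \<open>a\<close> remains outside the bracket.\<close>
  let ?V = "Y * (T * d - cnj b * c\<^sup>2 - 2 * cnj a * b * c + a * c / 6) + (cnj a)\<^sup>2 * b ^ 3
      - a * cnj a * b\<^sup>2 / 6 - X * b\<^sup>2 / 2 - a\<^sup>2 * b / 12"
  have L: "?L = X * ?V - 5 * a ^ 4 / 96"
    unfolding p1 p2 p3 q1 q2 r1 abcd(1)[symmetric]
    by (simp add: field_simps power2_eq_square power3_eq_cube)
  \<comment> \<open>The bound on \<open>d\<close> turns \<open>T * d\<close> into
    \<open>1 - t^2\<close>, which merges with \<open>y * t^2\<close> to the term
    \<open>1 - (1 - y) * t^2\<close> of the real inequality.\<close>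
  have "norm (T * d - cnj b * c\<^sup>2 - 2 * cnj a * b * c + a * c / 6)
      \<le> norm (T * d) + norm (cnj b * c\<^sup>2) + norm (2 * cnj a * b * c) + norm (a * c / 6)"
    by (intro order_trans[OF norm_triangle_ineq] order_trans[OF norm_triangle_ineq4] add_mono order_refl)
  also have "\<dots> \<le> T + y * t\<^sup>2 + 2 * x * y * t + x * t / 6"
    using le1(4) XYT0 by (simp add: norm_mult norm_power norm_divide xyt mult_left_le)
  finally have W: "norm (T * d - cnj b * c\<^sup>2 - 2 * cnj a * b * c + a * c / 6)
      \<le> 1 - (1 - y) * t\<^sup>2 + (2 * y + 1 / 6) * x * t"
    by (simp add: XYT algebra_simps)
  have "norm ?V \<le> norm (Y * (T * d - cnj b * c\<^sup>2 - 2 * cnj a * b * c + a * c / 6)) + norm ((cnj a)\<^sup>2 * b ^ 3)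
      + norm (a * cnj a * b\<^sup>2 / 6) + norm (X * b\<^sup>2 / 2) + norm (a\<^sup>2 * b / 12)"
    by (intro order_trans[OF norm_triangle_ineq] order_trans[OF norm_triangle_ineq4] add_mono order_refl)
  also have "\<dots> \<le> Y * (1 - (1 - y) * t\<^sup>2 + (2 * y + 1 / 6) * x * t) + x\<^sup>2 * y ^ 3
           + x\<^sup>2 * y\<^sup>2 / 6 + X * y\<^sup>2 / 2 + x\<^sup>2 * y / 12"
    using mult_left_mono[OF W XYT0(2)] XYT0
    by (simp add: norm_mult norm_power norm_divide xyt[symmetric] power2_eq_square)
  finally have V: "norm ?V \<le> Y * (1 - (1 - y) * t\<^sup>2 + (2 * y + 1 / 6) * x * t) + x\<^sup>2 * y ^ 3
           + x\<^sup>2 * y\<^sup>2 / 6 + X * y\<^sup>2 / 2 + x\<^sup>2 * y / 12" .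
  have "norm ?L \<le> X * norm ?V + 5 * x ^ 4 / 96"
    unfolding L using XYT0
    by (intro order_trans[OF norm_triangle_ineq4]) (simp add: norm_mult norm_power norm_divide xyt[symmetric])
  also have "\<dots> \<le> 1"
    using mult_left_mono[OF V XYT0(1)] Schur_parameter_inequality[OF ge0(1) le1(1) ge0(2) le1(2) ge0(3) le1(3)]
    unfolding XYT by linarith
  finally show ?thesis .
qed

section \<open>The upper bound on \<open>SL_star\<close>\<close>

lemma normalized_expansion_fps:
  assumes "normalized_expansion f a"
  shows "f has_fps_expansion Abs_fps (\<lambda>n. if n = 0 then 0 else if n = 1 then 1 else a n)"
    (is "f has_fps_expansion ?F")
proof (rule has_fps_expansionI)
  have "(\<lambda>n. fps_nth ?F n * z ^ n) sums f z" if "z \<in> ball 0 1" for z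
  proof -
    have "(\<Sum>n<2. fps_nth ?F n * z ^ n) = z"
      by (simp add: numeral_2_eq_2)
    moreover have "(\<lambda>n. fps_nth ?F (n + 2) * z ^ (n + 2)) sums (f z - z)"
      using assms that by (simp add: normalized_expansion_def)
    ultimately show ?thesis
      using sums_iff_shift[of "\<lambda>n. fps_nth ?F n * z ^ n" 2 "f z - z"] by simp
  qed
  then show "eventually (\<lambda>z. (\<lambda>n. fps_nth ?F n * z ^ n) sums f z) (nhds 0)"
    by (intro eventually_nhds_in_open[of "ball 0 1", THEN eventually_mono]) auto
qed

text \<open>This serves both directions: \<open>g\<close> is the Schwarz quotient of a general
  subordinating function for the bound, and the cube of \<open>z\<close> for sharpness.\<close>

lemma normalized_expansion_functional:
  assumes f: "normalized_expansion f a"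
    and h: "h holomorphic_on ball 0 1" "h 0 = 1"
    and fh: "\<And>z. norm z < 1 \<Longrightarrow> z * deriv f z = f z * h z"
    and g: "g has_fps_expansion P" and hg: "\<And>z. norm z < 1 \<Longrightarrow> (h z)\<^sup>2 = 1 + z * g z"
  shows "8 * (a 5 - (a 3)\<^sup>2) = fps_nth P 3 + fps_nth P 0 * fps_nth P 2 / 6
     - (fps_nth P 1)\<^sup>2 / 2 - (fps_nth P 0)\<^sup>2 * fps_nth P 1 / 12 - 5 * fps_nth P 0 ^ 4 / 96"
proof -
  define F where "F = Abs_fps (\<lambda>n. if n = 0 then 0 else if n = 1 then 1 else a n)"
  define H where "H = fps_expansion h 0"
  have F: "f has_fps_expansion F"
    unfolding F_def by (rule normalized_expansion_fps[OF f])
  have H: "h has_fps_expansion H"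
    unfolding H_def by (rule holomorphic_unit_disk_fps[OF h(1)])
  have "fps_X * fps_deriv F = F * H"
    by (rule fps_eqI_unit_disk[where f = "\<lambda>z. z * deriv f z" and g = "\<lambda>z. f z * h z"])
       (use fh in \<open>auto intro!: fps_expansion_intros F H\<close>)
  moreover have "H * H = 1 + fps_X * P"
    by (rule fps_eqI_unit_disk[where f = "\<lambda>z. h z * h z" and g = "\<lambda>z. 1 + z * g z"])
       (use hg in \<open>auto simp: power2_eq_square intro!: fps_expansion_intros g H\<close>)
  moreover have "fps_nth H 0 = 1"
    using has_fps_expansion_imp_0_eq_fps_nth_0[OF H] h(2) by simp
  ultimately show ?thesis
    using sqrt_log_deriv_coeffs[of F H P] by (simp add: F_def)
qed

text \<open>The real part of \<open>1 + z\<close> is positive. This gives both holomorphy and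
  nonvanishing of \<open>csqrt (1 + z)\<close>.\<close>

lemma one_plus_not_nonpos_Reals:
  fixes z :: complex
  assumes "norm z < 1"
  shows "1 + z \<notin> \<real>\<^sub>\<le>\<^sub>0"
  using assms abs_Re_le_cmod[of z] by (auto simp: complex_nonpos_Reals_iff)

lemma SL_star_bound:
  assumes f: "f \<in> SL_star" and a: "normalized_expansion f a"
  shows "cmod ((a 3)\<^sup>2 - a 5) \<le> 1 / 8"
proof -
  define h where "h = log_deriv_quotient f"
  have "subordinate h (\<lambda>z. csqrt (1 + z))"
    using f by (simp add: SL_star_def h_def)
  then obtain \<omega> where h: "h holomorphic_on ball 0 1"
    and \<omega>: "\<omega> holomorphic_on ball 0 1" "\<omega> 0 = 0" "\<forall>z\<in>ball 0 1. norm (\<omega> z) < 1"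
    and h\<omega>: "\<forall>z\<in>ball 0 1. h z = csqrt (1 + \<omega> z)"
    unfolding subordinate_def by blast
  have \<omega>_lt: "norm (\<omega> z) < 1" and h_eq: "h z = csqrt (1 + \<omega> z)" if "norm z < 1" for z
    using \<omega>(3) h\<omega> that by auto
  obtain g where g: "g holomorphic_on ball 0 1" "\<And>z. norm z < 1 \<Longrightarrow> \<omega> z = z * g z"
    "\<And>z. norm z < 1 \<Longrightarrow> norm (g z) \<le> 1"
    using Schwarz_factor[OF \<omega>(1,2) \<omega>_lt] by blast
  have h0: "h 0 = 1" by (simp add: h_def log_deriv_quotient_def)
  have f0: "f 0 = 0"
    using has_fps_expansion_imp_0_eq_fps_nth_0[OF normalized_expansion_fps[OF a]] by simp
  have "z * deriv f z = f z * h z" if z: "norm z < 1" for z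
  proof -
    \<comment> \<open>Since division by 0 gives 0, a zero of \<open>f\<close> away from the origin
      would make \<open>h\<close> vanish; hence multiplying by \<open>f z\<close> is
      legitimate.\<close>
    have "h z \<noteq> 0"
      using h_eq[OF z] one_plus_not_nonpos_Reals[OF \<omega>_lt[OF z]] by auto
    then show ?thesis
      using f0 by (auto simp: h_def log_deriv_quotient_def)
  qed
  moreover have "(h z)\<^sup>2 = 1 + z * g z" if z: "norm z < 1" for z
    using h_eq[OF z] g(2)[OF z] by simp
  ultimately have "norm (8 * (a 5 - (a 3)\<^sup>2)) \<le> 1"
    using normalized_expansion_functional[OF a h h0 _ holomorphic_unit_disk_fps[OF g(1)]]
      bounded_coeff_functional_le_1[OF g(1,3) holomorphic_unit_disk_fps[OF g(1)]]
    by simp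
  then show ?thesis
    unfolding norm_mult by (simp add: norm_minus_commute)
qed

section \<open>The extremal function\<close>

text \<open>Take \<open>f z = z * exp (G z - G 0)\<close> with \<open>G\<close> a primitive of
  \<open>q\<close>; subtracting \<open>G 0\<close> normalizes the derivative at the origin to
  1.\<close>

lemma log_deriv_quotient_exp_primitive:
  assumes q: "q holomorphic_on ball 0 1"
  obtains f where "f holomorphic_on ball 0 1" "f 0 = 0" "deriv f 0 = 1"
    "\<And>z. norm z < 1 \<Longrightarrow> z \<noteq> 0 \<Longrightarrow> f z \<noteq> 0"
    "\<And>z. norm z < 1 \<Longrightarrow> log_deriv_quotient f z = 1 + z * q z"
proof -
  obtain G where "\<And>z. z \<in> ball 0 1 \<Longrightarrow> (G has_field_derivative q z) (at z within ball 0 1)"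
    using holomorphic_convex_primitive'[OF _ _ q] by auto
  then have G: "(G has_field_derivative q z) (at z)" if "norm z < 1" for z
    using that at_within_open[of z "ball 0 1"] by (metis mem_ball_0 open_ball)
  define f where "f z = z * exp (G z - G 0)" for z
  have f': "(f has_field_derivative exp (G z - G 0) * (1 + z * q z)) (at z)" if "norm z < 1" for z
    unfolding f_def by (auto intro!: derivative_eq_intros G that simp: algebra_simps)
  show ?thesis
  proof
    show "f holomorphic_on ball 0 1"
      using f' by (meson holomorphic_on_open mem_ball_0 open_ball)
    show "log_deriv_quotient f z = 1 + z * q z" if "norm z < 1" for z
      using DERIV_imp_deriv[OF f'[OF that]] by (simp add: log_deriv_quotient_def f_def)
  qed (use DERIV_imp_deriv[OF f'[of 0]] in \<open>auto simp: f_def\<close>)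
qed

lemma normalized_expansion_fps_expansion:
  assumes f: "f holomorphic_on ball 0 1" "f 0 = 0" "deriv f 0 = 1"
  shows "normalized_expansion f (fps_nth (fps_expansion f 0))"
  unfolding normalized_expansion_def
proof
  fix z :: complex
  assume z: "z \<in> ball 0 1"
  have "(\<lambda>n. fps_nth (fps_expansion f 0) n * z ^ n) sums f z"
    using holomorphic_power_series[OF f(1) z] by (simp add: fps_expansion_def)
  then have "(\<lambda>n. fps_nth (fps_expansion f 0) (n + 2) * z ^ (n + 2))
      sums (f z - (\<Sum>n<2. fps_nth (fps_expansion f 0) n * z ^ n))"
    by (subst sums_iff_shift) simp
  then show "(\<lambda>n. fps_nth (fps_expansion f 0) (n + 2) * z ^ (n + 2)) sums (f z - z)"
    using f by (simp add: numeral_2_eq_2 fps_expansion_def)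
qed

lemma SL_star_sharp:
  "\<exists>f a. f \<in> SL_star \<and> normalized_expansion f a \<and> cmod ((a 3)\<^sup>2 - a 5) = 1 / 8"
proof -
  define h where "h z = csqrt (1 + z ^ 4)" for z :: complex
  have z4: "norm (z ^ 4) < 1" if "norm z < 1" for z :: complex
    using that by (simp add: norm_power power_less_one_iff)
  have h: "h holomorphic_on ball 0 1"
    unfolding h_def by (intro holomorphic_intros one_plus_not_nonpos_Reals z4) auto
  have "(\<lambda>z. h z - 1) holomorphic_on ball 0 1"
    by (intro holomorphic_intros h)
  \<comment> \<open>The Schwarz factorization serves only to divide \<open>h - 1\<close> by
    \<open>z\<close>, which puts \<open>h\<close> into the form \<open>1 + z * q z\<close>.\<close>
  then obtain q where q: "q holomorphic_on ball 0 1" "\<And>z. norm z < 1 \<Longrightarrow> h z - 1 = z * q z"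
    by (rule Schwarz3) (auto simp: h_def)
  obtain f where f: "f holomorphic_on ball 0 1" "f 0 = 0" "deriv f 0 = 1"
    "\<And>z. norm z < 1 \<Longrightarrow> z \<noteq> 0 \<Longrightarrow> f z \<noteq> 0"
    "\<And>z. norm z < 1 \<Longrightarrow> log_deriv_quotient f z = 1 + z * q z"
    using log_deriv_quotient_exp_primitive[OF q(1)] by blast
  have fh: "log_deriv_quotient f z = h z" if "norm z < 1" for z
    using f(5)[OF that] q(2)[OF that] by (metis add.commute diff_add_cancel)
  define a where "a = fps_nth (fps_expansion f 0)"
  have a: "normalized_expansion f a"
    unfolding a_def by (rule normalized_expansion_fps_expansion[OF f(1-3)])
  have "log_deriv_quotient f holomorphic_on ball 0 1"
    by (rule holomorphic_transform[OF h]) (simp add: fh)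
  moreover have "(\<lambda>z. csqrt (1 + z)) holomorphic_on ball 0 1"
    by (intro holomorphic_intros one_plus_not_nonpos_Reals) auto
  ultimately have "subordinate (log_deriv_quotient f) (\<lambda>z. csqrt (1 + z))"
    unfolding subordinate_def
    by (auto intro!: exI[of _ "\<lambda>z. z ^ 4"] holomorphic_intros simp: fh h_def z4)
  then have "f \<in> SL_star"
    using f(1) a by (auto simp: SL_star_def class_A_def)
  \<comment> \<open>The series \<open>fps_X ^ 3\<close> has coefficient 3 equal to 1 and
    coefficients 0 to 2 equal to 0, so the functional equals 1.\<close>
  moreover have "8 * (a 5 - (a 3)\<^sup>2) = 1"
  proof (subst normalized_expansion_functional[OF a h])
    show "z * deriv f z = f z * h z" if z: "norm z < 1" for z
      using f(2) f(4)[OF z] fh[OF z] by (cases "z = 0") (auto simp: log_deriv_quotient_def field_simps)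
    show "(\<lambda>z. z ^ 3) has_fps_expansion fps_X ^ 3"
      by (rule has_fps_expansion_fps_X_power)
    show "(h z)\<^sup>2 = 1 + z * z ^ 3" for z
      by (simp add: h_def flip: power_Suc)
  qed (simp_all add: h_def)
  then have "norm (8 * (a 5 - (a 3)\<^sup>2)) = 1" by simp
  then have "cmod ((a 3)\<^sup>2 - a 5) = 1 / 8"
    unfolding norm_mult by (simp add: norm_minus_commute)
  ultimately show ?thesis using a by blast
qed

theorem theorem2p3:
  shows "(\<forall>f a. f \<in> SL_star \<and> normalized_expansion f a \<longrightarrow>
            cmod ((a 3)\<^sup>2 - a 5) \<le> 1 / 8) \<and>
         (\<exists>f a. f \<in> SL_star \<and> normalized_expansion f a \<and>
            cmod ((a 3)\<^sup>2 - a 5) = 1 / 8)"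
  using SL_star_bound SL_star_sharp by blast

end
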